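(* Let $n\ge 2$ be an integer and let $\mathfrak{A}=e_1\mathfrak{A}e_1+e_1\mathfrak{A}e_2+e_2\mathfrak{A}e_2$ be a $2$-torsion free triangular ring. Then for every multiplicative generalized Jordan $n$-derivation $\Delta:\mathfrak{A}\rightarrow\mathfrak{A}$ there exist $\mu\in\mathcal{Z}(\mathfrak{A})$ and a derivation $\delta:\mathfrak{A}\rightarrow\mathfrak{A}$ such that $\Delta(t)=\mu t+\delta(t)$ for all $t\in\mathfrak{A}$.
   Context: Rings are associative with identity; $\mathcal{Z}(\mathfrak{A})$ is the center of $\mathfrak{A}$. A ring is $2$-torsion free if $2t=0$ implies $t=0$. An idempotent is nontrivial if it is different from $0$ and $1$. A triangular ring is a unital ring $\mathfrak{A}$ with a nontrivial idempotent $e_1$ such that, with $e_2=1-e_1$, $e_1\mathfrak{A}e_2$ is a faithful $(e_1\mathfrak{A}e_1,e_2\mathfrak{A}e_2)$-bimodule (i.e. faithful as a left $e_1\mathfrak{A}e_1$-module and as a right $e_2\mathfrak{A}e_2$-module) and $e_2\mathfrak{A}e_1=\{0\}$. The Jordan product is $t_1\circ t_2=t_1t_2+t_2t_1$. Set $q_1(t_1)=t_1$ and $q_n(t_1,\ldots,t_n)=q_{n-1}(t_1,\ldots,t_{n-1})\circ t_n$ for $n\ge 2$. A map $\delta:\mathfrak{A}\to\mathfrak{A}$ (not assumed additive) is a multiplicative Jordan $n$-derivation if $\delta(q_n(t_1,\ldots,t_n))=\sum_{i=1}^n q_n(t_1,\ldots,t_{i-1},\delta(t_i),t_{i+1},\ldots,t_n)$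 for all $t_1,\ldots,t_n\in\mathfrak{A}$. A map $\Delta:\mathfrak{A}\to\mathfrak{A}$ (not assumed additive) is a multiplicative generalized Jordan $n$-derivation if there exists a multiplicative Jordan $n$-derivation $\delta:\mathfrak{A}\to\mathfrak{A}$ (not assumed additive) such that $\Delta(q_n(t_1,\ldots,t_n))=q_n(\Delta(t_1),t_2,\ldots,t_n)+\sum_{i=2}^n q_n(t_1,\ldots,t_{i-1},\delta(t_i),t_{i+1},\ldots,t_n)$ for all $t_1,\ldots,t_n\in\mathfrak{A}$. A derivation is an additive map $d$ with $d(t_1t_2)=d(t_1)t_2+t_1d(t_2)$ for all $t_1,t_2$. *)

theory Defs
  imports Main
begin

definition ring_center :: "'a::ring_1 set" where
  "ring_center = {z. \<forall>x. z * x = x * z}"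

definition two_torsion_free :: "'a::ring_1 itself \<Rightarrow> bool" where
  "two_torsion_free _ \<longleftrightarrow> (\<forall>t::'a. 2 * t = 0 \<longrightarrow> t = 0)"

definition idempotent :: "'a::ring_1 \<Rightarrow> bool" where
  "idempotent e \<longleftrightarrow> e * e = e"

definition nontrivial_idempotent :: "'a::ring_1 \<Rightarrow> bool" where
  "nontrivial_idempotent e \<longleftrightarrow> idempotent e \<and> e \<noteq> 0 \<and> e \<noteq> 1"

definition peirce :: "'a::ring_1 \<Rightarrow> 'a \<Rightarrow> 'a set" where
  "peirce e f = {e * a * f | a. True}"

definition faithful_left :: "'a::ring_1 set \<Rightarrow> 'a set \<Rightarrow> bool" where
  "faithful_left R M \<longleftrightarrow> (\<forall>a\<in>R. (\<forall>m\<in>M. a * m = 0) \<longrightarrow> a = 0)"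

definition faithful_right :: "'a::ring_1 set \<Rightarrow> 'a set \<Rightarrow> bool" where
  "faithful_right M S \<longleftrightarrow> (\<forall>b\<in>S. (\<forall>m\<in>M. m * b = 0) \<longrightarrow> b = 0)"

text \<open>The ring is the whole type \<open>'a\<close>. Since \<open>e\<close> is idempotent, the corners
  \<open>peirce e e\<close> and \<open>peirce (1 - e) (1 - e)\<close> are rings acting on
  \<open>peirce e (1 - e)\<close> by multiplication, so only faithfulness has to be required.\<close>

definition triangular_ring :: "'a::ring_1 \<Rightarrow> bool" where
  "triangular_ring e \<longleftrightarrow>
     nontrivial_idempotent e \<and>
     faithful_left (peirce e e) (peirce e (1 - e)) \<and>
     faithful_right (peirce e (1 - e)) (peirce (1 - e) (1 - e)) \<and>
     peirce (1 - e) e = {0}"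

definition jordan_prod :: "'a::ring_1 \<Rightarrow> 'a \<Rightarrow> 'a"  (infixl "\<circ>\<^sub>J" 70) where
  "x \<circ>\<^sub>J y = x * y + y * x"

text \<open>A tuple \<open>(t\<^sub>1, \<dots>, t\<^sub>n)\<close> is given by a sequence \<open>t\<close>, of which
  \<open>jordan_q n\<close> reads only the entries \<open>t 1, \<dots>, t n\<close>. The value at \<open>n = 0\<close> is a dummy.\<close>

fun jordan_q :: "nat \<Rightarrow> (nat \<Rightarrow> 'a::ring_1) \<Rightarrow> 'a" where
  "jordan_q 0 t = 0"
| "jordan_q (Suc 0) t = t 1"
| "jordan_q (Suc (Suc n)) t = jordan_q (Suc n) t \<circ>\<^sub>J t (Suc (Suc n))"

definition mult_jordan_derivation :: "nat \<Rightarrow> ('a::ring_1 \<Rightarrow> 'a) \<Rightarrow> bool" where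
  "mult_jordan_derivation n \<delta> \<longleftrightarrow>
     (\<forall>t. \<delta> (jordan_q n t) = (\<Sum>i=1..n. jordan_q n (t(i := \<delta> (t i)))))"

definition mult_gen_jordan_derivation :: "nat \<Rightarrow> ('a::ring_1 \<Rightarrow> 'a) \<Rightarrow> bool" where
  "mult_gen_jordan_derivation n \<Delta> \<longleftrightarrow>
     (\<exists>\<delta>. mult_jordan_derivation n \<delta> \<and>
       (\<forall>t. \<Delta> (jordan_q n t) =
          jordan_q n (t(1 := \<Delta> (t 1))) + (\<Sum>i=2..n. jordan_q n (t(i := \<delta> (t i))))))"

definition ring_derivation :: "('a::ring_1 \<Rightarrow> 'a) \<Rightarrow> bool" where
  "ring_derivation d \<longleftrightarrow>
     (\<forall>s t. d (s + t) = d s + d t) \<and> (\<forall>s t. d (s * t) = d s * t + s * d t)"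

end

theory Submission
  imports Defs
begin

text \<open>
  Let \<open>A\<close> be the ring and let \<open>\<delta>\<close> be the Jordan \<open>n\<close>-derivation that accompanies \<open>\<Delta>\<close>, and write \<open>n = k + 2\<close>.
  Evaluating the defining identities at \<open>(x, y, 1, \<dots>, 1)\<close>, where \<open>q\<close> has the value
  \<open>2 ^ k * (x \<circ>\<^sub>J y)\<close>, leaves identities in two variables, in which powers of two can be
  cancelled although they need not be invertible.

  The difference \<open>G = \<Delta> - \<delta>\<close> satisfies \<open>G (2 ^ k * (x \<circ>\<^sub>J y)) = 2 ^ k * (G x \<circ>\<^sub>J y)\<close>. Putting
  one argument equal to \<open>1\<close> gives \<open>2 * G x = G 1 \<circ>\<^sub>J x\<close>; hence \<open>c = G 1\<close> satisfies
  \<open>c \<circ>\<^sub>J (x \<circ>\<^sub>J y) = (c \<circ>\<^sub>J x) \<circ>\<^sub>J y\<close>. In a triangular ring this forces \<open>c\<close> to be central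
  (\<open>central_if_jordan_centralizer\<close>), and then \<open>G x = c * x\<close>.

  For \<open>\<delta>\<close> one cannot expect a derivation: if a central \<open>u\<close> satisfies
  \<open>of_nat (n - 1) * u = 0\<close>, then \<open>\<lambda>x. u * x\<close> is a Jordan \<open>n\<close>-derivation. What is true is that
  \<open>u = \<delta> 1\<close> is central and that \<open>\<lambda>x. \<delta> x - u * x\<close> is a derivation
  (\<open>jordan_n_derivation_form\<close>). The defect \<open>D x = \<delta> (2 * x) - 2 * \<delta> x\<close> of homogeneity turns out
  to satisfy \<open>D (x \<circ>\<^sub>J y) = D x \<circ>\<^sub>J y\<close>, so it is also multiplication by a central element \<open>v\<close>;
  the Peirce components of the identity at \<open>e\<close>, at \<open>f = 1 - e\<close> and at elements of the
  bimodule give \<open>v = 0\<close> and the centrality of \<open>u\<close>.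

  After subtracting \<open>u * x\<close> there remains a map \<open>d\<close> with \<open>d (x \<circ>\<^sub>J y) = d x \<circ>\<^sub>J y + x \<circ>\<^sub>J d y\<close>
  and \<open>d (2 * x) = 2 * d x\<close>. An inner derivation is removed to make \<open>d e = d f = 0\<close>. Then \<open>d\<close>
  preserves the bimodule \<open>e A f\<close> and is additive and satisfies the product rule with one
  factor in it, and faithfulness of the bimodule carries both properties over to the
  whole ring (\<open>jordan_derivation_normalized\<close>).
\<close>

section \<open>Jordan products with scalars and the polynomials q\<close>

lemma jordan_prod_add_left: "(x + y) \<circ>\<^sub>J z = x \<circ>\<^sub>J z + y \<circ>\<^sub>J z"
  and jordan_prod_add_right: "z \<circ>\<^sub>J (x + y) = z \<circ>\<^sub>J x + z \<circ>\<^sub>J y"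
  and jordan_prod_diff_left: "(x - y) \<circ>\<^sub>J z = x \<circ>\<^sub>J z - y \<circ>\<^sub>J z"
  and jordan_prod_commute: "x \<circ>\<^sub>J y = y \<circ>\<^sub>J x"
  and jordan_prod_one_right: "x \<circ>\<^sub>J 1 = 2 * x"
  and jordan_prod_one_left: "1 \<circ>\<^sub>J x = 2 * x"
  by (simp_all add: jordan_prod_def algebra_simps mult_2 mult_2_right)

lemma two_power_commute: "(x::'a::ring_1) * 2 ^ k = 2 ^ k * x"
  by (metis mult_of_nat_commute of_nat_numeral of_nat_power)

lemma jordan_prod_two_power_left: "(2 ^ k * x) \<circ>\<^sub>J y = 2 ^ k * (x \<circ>\<^sub>J y)"
proof -
  have "y * (2 ^ k * x) = 2 ^ k * (y * x)"
    by (metis two_power_commute mult.assoc)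
  then show ?thesis by (simp add: jordan_prod_def distrib_left mult.assoc)
qed

lemma jordan_prod_two_power_right: "x \<circ>\<^sub>J (2 ^ k * y) = 2 ^ k * (x \<circ>\<^sub>J y)"
  using jordan_prod_two_power_left jordan_prod_commute by metis

lemmas jordan_prod_two_left = jordan_prod_two_power_left [where k = 1, simplified]
lemmas jordan_prod_two_right = jordan_prod_two_power_right [where k = 1, simplified]

lemma jordan_q_cong:
  assumes "\<And>i. 1 \<le> i \<Longrightarrow> i \<le> n \<Longrightarrow> s i = t i"
  shows "jordan_q n s = jordan_q n t"
  using assms by (induction n t rule: jordan_q.induct) simp_all

lemma jordan_q_step: "jordan_q (Suc k + 2) t = jordan_q (k + 2) t \<circ>\<^sub>J t (k + 3)"
  by (simp add: numeral_3_eq_3)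

lemma jordan_q_padded:
  assumes "\<And>i. i \<ge> 3 \<Longrightarrow> t i = 1"
  shows "jordan_q (k + 2) t = 2 ^ k * (t 1 \<circ>\<^sub>J t 2)"
proof (induction k)
  case 0
  then show ?case by (simp add: numeral_2_eq_2)
next
  case (Suc k)
  then show ?case
    using assms [of "k + 3"] unfolding jordan_q_step by (simp add: jordan_prod_one_right mult.assoc)
qed

text \<open>The value without the leading factor \<open>2\<close> carries the power \<open>2 ^ (k - 1)\<close>;
  doubling avoids the truncated exponent.\<close>

lemma jordan_q_padded_upd:
  assumes "\<And>i. i \<ge> 3 \<Longrightarrow> t i = 1" and "j \<ge> 3" and "j \<le> k + 2"
  shows "2 * jordan_q (k + 2) (t(j := u)) = 2 ^ k * ((t 1 \<circ>\<^sub>J t 2) \<circ>\<^sub>J u)"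
  using assms(3)
proof (induction k)
  case 0
  then show ?case using assms(2) by simp
next
  case (Suc k)
  show ?case
  proof (cases "j = k + 3")
    case True
    have "jordan_q (k + 2) (t(j := u)) = jordan_q (k + 2) t"
      using True by (intro jordan_q_cong) simp
    then have "jordan_q (k + 2) (t(j := u)) = 2 ^ k * (t 1 \<circ>\<^sub>J t 2)"
      using jordan_q_padded [OF assms(1)] by simp
    moreover have "jordan_q (Suc k + 2) (t(j := u)) = jordan_q (k + 2) (t(j := u)) \<circ>\<^sub>J u"
      using True by (simp only: jordan_q_step fun_upd_same)
    ultimately show ?thesis
      by (simp only: jordan_prod_two_power_left mult.assoc power_Suc)
  next
    case False
    then have "j \<le> k + 2" using Suc.prems by simp
    then have "2 * jordan_q (k + 2) (t(j := u)) = 2 ^ k * ((t 1 \<circ>\<^sub>J t 2) \<circ>\<^sub>J u)"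
      by (rule Suc.IH)
    moreover have "(t(j := u)) (k + 3) = 1" using False assms(1) by simp
    then have "jordan_q (Suc k + 2) (t(j := u)) = 2 * jordan_q (k + 2) (t(j := u))"
      by (simp only: jordan_q_step jordan_prod_one_right)
    ultimately show ?thesis by (simp only: mult.assoc power_Suc)
  qed
qed

text \<open>At \<open>(x, y, 1, \<dots>, 1)\<close> each of the \<open>k\<close> entries \<open>1\<close> contributes the same summand, in which
  this entry is replaced by \<open>\<delta> 1\<close>.\<close>

lemma mult_jordan_derivation_two_args:
  fixes \<delta> :: "'a::ring_1 \<Rightarrow> 'a"
  assumes "mult_jordan_derivation (k + 2) \<delta>"
  shows "2 * \<delta> (2 ^ k * (x \<circ>\<^sub>J y)) =
    2 * (2 ^ k * (\<delta> x \<circ>\<^sub>J y + x \<circ>\<^sub>J \<delta> y)) + of_nat k * (2 ^ k * ((x \<circ>\<^sub>J y) \<circ>\<^sub>J \<delta> 1))"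
proof -
  define t where "t = (\<lambda>_::nat. 1::'a)(1 := x, 2 := y)"
  have t: "t i = 1" if "i \<ge> 3" for i using that by (simp add: t_def)
  have t12: "t 1 = x" "t 2 = y" by (simp_all add: t_def)
  let ?q = "\<lambda>i. jordan_q (k + 2) (t(i := \<delta> (t i)))"
  have 1: "?q 1 = 2 ^ k * (\<delta> x \<circ>\<^sub>J y)"
    by (subst jordan_q_padded) (simp_all add: t t12 t12 [simplified])
  have 2: "?q 2 = 2 ^ k * (x \<circ>\<^sub>J \<delta> y)"
    by (subst jordan_q_padded) (simp_all add: t t12 t12 [simplified])
  have 3: "2 * ?q i = 2 ^ k * ((x \<circ>\<^sub>J y) \<circ>\<^sub>J \<delta> 1)" if "i \<in> {3..k+2}" for i
    using that jordan_q_padded_upd [of t i k "\<delta> (t i)", OF t] t [of i] t12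
    by (simp only: atLeastAtMost_iff)
  have split: "{1..k+2} = {1,2} \<union> {3..k+2}" by auto
  have "2 * \<delta> (2 ^ k * (x \<circ>\<^sub>J y)) = 2 * (\<Sum>i=1..k+2. ?q i)"
    using assms jordan_q_padded [of t k, OF t] t12 unfolding mult_jordan_derivation_def by metis
  also have "\<dots> = 2 * ?q 1 + 2 * ?q 2 + (\<Sum>i=3..k+2. 2 * ?q i)"
    unfolding split by (subst sum.union_disjoint) (auto simp: distrib_left sum_distrib_left)
  also have "\<dots> = 2 * (?q 1 + ?q 2) + (\<Sum>i=3..k+2. 2 ^ k * ((x \<circ>\<^sub>J y) \<circ>\<^sub>J \<delta> 1))"
    using 3 by (simp add: distrib_left)
  finally show ?thesis
    unfolding 1 2 by (simp add: distrib_left)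
qed

text \<open>The summands for the positions \<open>2, \<dots>, n\<close> are the same for \<open>\<Delta>\<close> and \<open>\<delta>\<close>, so only the
  first position survives in the difference.\<close>

lemma gen_minus_derivation_two_args:
  fixes \<delta> \<Delta> :: "'a::ring_1 \<Rightarrow> 'a"
  assumes \<delta>: "mult_jordan_derivation (k + 2) \<delta>"
    and \<Delta>: "\<And>t. \<Delta> (jordan_q (k + 2) t) = jordan_q (k + 2) (t(1 := \<Delta> (t 1)))
          + (\<Sum>i=2..k+2. jordan_q (k + 2) (t(i := \<delta> (t i))))"
  shows "\<Delta> (2 ^ k * (x \<circ>\<^sub>J y)) - \<delta> (2 ^ k * (x \<circ>\<^sub>J y)) = 2 ^ k * ((\<Delta> x - \<delta> x) \<circ>\<^sub>J y)"
proof -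
  define t where "t = (\<lambda>_::nat. 1::'a)(1 := x, 2 := y)"
  have t: "t i = 1" if "i \<ge> 3" for i using that by (simp add: t_def)
  have t12: "t 1 = x" "t 2 = y" by (simp_all add: t_def)
  have q: "jordan_q (k + 2) (t(1 := z)) = 2 ^ k * (z \<circ>\<^sub>J y)" for z
    by (subst jordan_q_padded) (simp_all add: t t12 t12 [simplified])
  have "\<delta> (jordan_q (k + 2) t) = jordan_q (k + 2) (t(1 := \<delta> (t 1)))
          + (\<Sum>i=2..k+2. jordan_q (k + 2) (t(i := \<delta> (t i))))"
    using \<delta> unfolding mult_jordan_derivation_def
    by (subst sum.atLeast_Suc_atMost [symmetric, of 1, unfolded Suc_1]) auto
  then have "\<Delta> (jordan_q (k + 2) t) - \<delta> (jordan_q (k + 2) t)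
      = jordan_q (k + 2) (t(1 := \<Delta> x)) - jordan_q (k + 2) (t(1 := \<delta> x))"
    using \<Delta> [of t] t12 by simp
  moreover have "jordan_q (k + 2) t = 2 ^ k * (x \<circ>\<^sub>J y)"
    using q [of x] t12 by (metis fun_upd_triv)
  ultimately show ?thesis
    by (simp only: q jordan_prod_diff_left right_diff_distrib)
qed

section \<open>Peirce decomposition of a triangular ring\<close>

locale triangular_two_torsion_free =
  fixes e f :: "'a::ring_1"
  assumes f_def: "f = 1 - e"
    and triangular: "triangular_ring e"
    and torsion_free: "two_torsion_free TYPE('a)"
begin

lemma two_cancel: "2 * x = 2 * y \<Longrightarrow> x = y" for x y :: 'a
  using torsion_free unfolding two_torsion_free_def
  by (metis eq_iff_diff_eq_0 right_diff_distrib)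

lemma double_zero: "x + x = 0 \<Longrightarrow> x = 0" for x :: 'a
  using two_cancel [of x 0] by (simp add: mult_2)

lemma two_power_cancel: "2 ^ k * x = 2 ^ k * y \<Longrightarrow> x = y" for x y :: 'a
  by (induction k) (auto simp: mult.assoc dest: two_cancel)

lemma e_idem: "e * e = e"
  using triangular by (simp add: triangular_ring_def nontrivial_idempotent_def idempotent_def)

lemma f_idem: "f * f = f" and ef_zero: "e * f = 0" and fe_zero: "f * e = 0"
  by (simp_all add: f_def algebra_simps e_idem)

lemma fxe_zero: "f * (x * e) = 0"
  using triangular unfolding triangular_ring_def peirce_def f_def by (auto simp: mult.assoc)

lemma one_eq: "1 = e + f"
  by (simp add: f_def)

lemma split_right: "x = x * e + x * f" and split_left: "x = e * x + f * x"
  using one_eq by (metis distrib_left mult.right_neutral, metis distrib_right mult.left_neutral)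

lemma exe_eq: "e * (x * e) = x * e"
  using split_left [of "x * e"] fxe_zero by simp

lemma fxf_eq: "f * (x * f) = f * x"
  using split_right [of "f * x"] fxe_zero by (simp add: mult.assoc)

lemma peirce_assoc:
  "e * (e * x) = e * x" "f * (f * x) = f * x" "e * (f * x) = 0" "f * (e * x) = 0"
  "f * (x * (e * y)) = 0" "e * (x * (e * y)) = x * (e * y)" "f * (x * (f * y)) = f * (x * y)"
proof -
  show "e * (e * x) = e * x" "f * (f * x) = f * x" "e * (f * x) = 0" "f * (e * x) = 0"
    by (simp_all add: mult.assoc [symmetric] e_idem f_idem ef_zero fe_zero)
  show "f * (x * (e * y)) = 0"
    using fxe_zero [of x] by (simp add: mult.assoc [symmetric])
  show "e * (x * (e * y)) = x * (e * y)"
    using exe_eq [of x] by (simp add: mult.assoc [symmetric])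
  show "f * (x * (f * y)) = f * (x * y)"
    using fxf_eq [of x] by (simp add: mult.assoc [symmetric])
qed

text \<open>Together with \<open>f x e = 0\<close>, the rules \<open>e x e = x e\<close> and \<open>f x f = f x\<close> bring every Peirce
  component of a polynomial expression to a normal form.\<close>

lemmas peirce_rules = e_idem f_idem ef_zero fe_zero fxe_zero exe_eq fxf_eq peirce_assoc mult.assoc
  distrib_left distrib_right left_diff_distrib right_diff_distrib mult_2 mult_2_right

lemma peirce_decomposition: "x = e * x * e + e * x * f + f * x * f"
proof -
  have "x = (e + f) * x * (e + f)" by (simp add: one_eq [symmetric])
  also have "\<dots> = e * x * e + e * x * f + f * x * f" by (simp add: peirce_rules)
  finally show ?thesis .
qed

lemma peirce_eqI:
  assumes "e * x * e = e * y * e" "e * x * f = e * y * f" "f * x * f = f * y * f"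
  shows "x = y"
  using assms peirce_decomposition by metis

lemma left_faithful:
  assumes "\<And>y. z * (e * y * f) = 0" shows "e * z * e = 0"
proof -
  have "(e * z * e) * (e * y * f) = 0" for y
    using assms [of y] by (simp add: peirce_rules)
  then show ?thesis
    using triangular unfolding triangular_ring_def faithful_left_def peirce_def f_def by blast
qed

lemma right_faithful:
  assumes "\<And>y. (e * y * f) * z = 0" shows "f * z * f = 0"
proof -
  have "(e * y * f) * (f * z * f) = 0" for y
    using assms [of y] by (simp add: peirce_rules)
  then show ?thesis
    using triangular unfolding triangular_ring_def faithful_right_def peirce_def f_def by blast
qed

text \<open>The diagonal components of an element are determined by its action on the bimodule
  \<open>e A f\<close>, the one in \<open>e A e\<close> on the left and the one in \<open>f A f\<close> on the right.\<close>

lemma zeroI: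
  assumes "\<And>y. z * (e * y * f) = 0" "\<And>y. (e * y * f) * z = 0" "e * z * f = 0"
  shows "z = 0"
  by - (rule peirce_eqI; simp add: left_faithful [OF assms(1)] right_faithful [OF assms(2)] assms(3))

text \<open>Products \<open>x m\<close> and \<open>m x\<close> with \<open>m\<close> in \<open>e A f\<close> lie in \<open>e A f\<close> again. If \<open>c\<close> commutes with them,
  the commutator of \<open>c\<close> and \<open>x\<close> annihilates the bimodule on both sides, and \<open>e c f = 0\<close> makes its
  remaining component vanish.\<close>

lemma centralI:
  assumes "e * c * f = 0" and comm: "\<And>y. c * (e * y * f) = (e * y * f) * c"
  shows "c \<in> ring_center"
proof -
  have "c * x - x * c = 0" for x
  proof (rule zeroI)
    fix y
    have "c * x * (e * y * f) = x * (e * y * f) * c"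
      using comm [of "x * e * y"] by (simp add: peirce_rules)
    then show "(c * x - x * c) * (e * y * f) = 0"
      using comm [of y] by (simp add: left_diff_distrib mult.assoc)
    have "(e * y * f) * x * c = c * ((e * y * f) * x)"
      using comm [of "y * f * x"] by (simp add: peirce_rules)
    then show "(e * y * f) * (c * x - x * c) = 0"
      using comm [of y] by (simp add: right_diff_distrib mult.assoc [symmetric])
  next
    have "e * (c * x) * f = e * ((c * e + c * f) * x) * f"
      by (simp flip: split_right)
    moreover have "e * (x * c) * f = e * (x * (e * c + f * c)) * f"
      by (simp flip: split_left)
    moreover have "e * (c * (f * x)) = 0"
      using arg_cong [OF assms(1), of "\<lambda>z. z * x"] by (simp add: mult.assoc)
    ultimately show "e * (c * x - x * c) * f = 0"
      using assms(1) comm [of x] by (simp add: peirce_rules)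
  qed
  then show ?thesis by (simp add: ring_center_def)
qed

text \<open>The identity says that every commutator of \<open>c\<close> is central. The commutator with \<open>e\<close> is
  \<open>- e c f\<close> and those with elements of \<open>e A f\<close> lie in \<open>e A f\<close>, where only \<open>0\<close> commutes with \<open>e\<close>.\<close>

lemma central_if_jordan_centralizer:
  fixes c :: 'a
  assumes J: "\<And>x y. c \<circ>\<^sub>J (x \<circ>\<^sub>J y) = (c \<circ>\<^sub>J x) \<circ>\<^sub>J y"
  shows "c \<in> ring_center"
proof -
  have comm: "x * (c * y - y * c) = (c * y - y * c) * x" for x y
    using J [of x y] by (simp add: jordan_prod_def algebra_simps)
  show ?thesis
  proof (rule centralI)
    show "e * c * f = 0"
      using arg_cong [OF comm [of e e], of "\<lambda>z. z * f"] by (simp add: peirce_rules)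
    fix y
    have "e * (c * (e * y * f)) = c * (e * y * f)"
      by (simp add: peirce_rules)
    then show "c * (e * y * f) = (e * y * f) * c"
      using comm [of e "e * y * f"] by (simp add: peirce_rules)
  qed
qed

section \<open>Multiplicative Jordan derivations of a triangular ring\<close>

text \<open>
  Since \<open>d e = d f = 0\<close>, the map \<open>d\<close> commutes with Jordan multiplication by \<open>e\<close> and by \<open>f\<close>. The
  composition of the two is the projection onto \<open>e A f\<close>, so \<open>d\<close> respects this component.
  Additivity there comes from the product
  \<open>(e + m) \<circ>\<^sub>J (f + m') = m + m'\<close>, whose factors are idempotents with \<open>d (e + m) = d m\<close> and
  \<open>d (f + m') = d m'\<close>. In \<open>(e \<circ>\<^sub>J x) \<circ>\<^sub>J m = 2 * (x * m)\<close> and \<open>m \<circ>\<^sub>J (f \<circ>\<^sub>J x) = 2 * (m * x)\<close> the Jordan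
  product has become one-sided, which yields the product rule for \<open>x * m\<close> and for \<open>m * x\<close>.
  The defects of additivity and of the product rule on the whole ring then annihilate
  \<open>e A f\<close> on both sides.
\<close>

lemma jordan_derivation_normalized:
  fixes d :: "'a \<Rightarrow> 'a"
  assumes J: "\<And>x y. d (x \<circ>\<^sub>J y) = d x \<circ>\<^sub>J y + x \<circ>\<^sub>J d y"
    and double: "\<And>x. d (2 * x) = 2 * d x"
    and de: "d e = 0" and df: "d f = 0"
  shows "ring_derivation d"
proof -
  have d0: "d 0 = 0" using double [of 0] by (simp add: mult_2)
  have dE: "d (e \<circ>\<^sub>J x) = e \<circ>\<^sub>J d x" for x using J [of e x] de by (simp add: jordan_prod_def)
  have dF: "d (f \<circ>\<^sub>J x) = f \<circ>\<^sub>J d x" for x using J [of f x] df by (simp add: jordan_prod_def)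
  have dM: "d (e * x * f) = e * d x * f" for x
    using dF [of "e \<circ>\<^sub>J x"] unfolding dE by (simp add: jordan_prod_def peirce_rules)
  have deM: "d (e + e * x * f) = e * d x * f" for x
  proof -
    let ?y = "e + e * x * f"
    have M: "e * d ?y * f = e * d x * f"
      using dM [of ?y] dM [of x] by (simp add: peirce_rules)
    have "f \<circ>\<^sub>J d ?y = e * d x * f"
      using dF [of ?y] dM [of x] by (simp add: jordan_prod_def peirce_rules)
    from arg_cong [OF this, of "\<lambda>z. f * z * f"] have S: "f * d ?y = 0"
      by - (rule double_zero; simp add: jordan_prod_def peirce_rules)
    \<comment> \<open>\<open>?y\<close> is idempotent, which kills the remaining diagonal component.\<close>
    have "?y \<circ>\<^sub>J ?y = 2 * ?y"
      by (simp add: jordan_prod_def peirce_rules algebra_simps)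
    then have "2 * d ?y = 2 * (d ?y \<circ>\<^sub>J ?y)"
      using J [of ?y ?y] double [of ?y] by (simp add: jordan_prod_commute mult_2)
    then have "d ?y = d ?y \<circ>\<^sub>J ?y" by (rule two_cancel)
    from arg_cong [OF this, of "\<lambda>z. e * z * e"] have R: "d ?y * e = 0"
      by (simp add: jordan_prod_def peirce_rules)
    show ?thesis
      using M R S by - (rule peirce_eqI; simp add: peirce_rules)
  qed
  have dfM: "d (f + e * x * f) = e * d x * f" for x
  proof -
    let ?y = "f + e * x * f"
    have M: "e * d ?y * f = e * d x * f"
      using dM [of ?y] dM [of x] by (simp add: peirce_rules)
    have "e \<circ>\<^sub>J d ?y = e * d x * f"
      using dE [of ?y] dM [of x] by (simp add: jordan_prod_def peirce_rules)
    from arg_cong [OF this, of "\<lambda>z. e * z * e"] have R: "d ?y * e = 0"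
      by - (rule double_zero; simp add: jordan_prod_def peirce_rules)
    have "?y \<circ>\<^sub>J ?y = 2 * ?y"
      by (simp add: jordan_prod_def peirce_rules algebra_simps)
    then have "2 * d ?y = 2 * (d ?y \<circ>\<^sub>J ?y)"
      using J [of ?y ?y] double [of ?y] by (simp add: jordan_prod_commute mult_2)
    then have "d ?y = d ?y \<circ>\<^sub>J ?y" by (rule two_cancel)
    from arg_cong [OF this, of "\<lambda>z. f * z * f"] have S: "f * d ?y = 0"
      by (simp add: jordan_prod_def peirce_rules)
    show ?thesis
      using M R S by - (rule peirce_eqI; simp add: peirce_rules)
  qed
  have addM: "e * d (x + y) * f = e * d x * f + e * d y * f" for x y
  proof -
    have "(e + e * x * f) \<circ>\<^sub>J (f + e * y * f) = e * (x + y) * f"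
      by (simp add: jordan_prod_def peirce_rules algebra_simps)
    then have "e * d (x + y) * f =
        d (e + e * x * f) \<circ>\<^sub>J (f + e * y * f) + (e + e * x * f) \<circ>\<^sub>J d (f + e * y * f)"
      using J dM by metis
    then show ?thesis
      unfolding deM dfM by (simp add: jordan_prod_def peirce_rules)
  qed
  have left: "d (x * (e * y * f)) = d x * (e * y * f) + x * d (e * y * f)" for x y
  proof -
    let ?m = "e * y * f"
    have "(e \<circ>\<^sub>J x) \<circ>\<^sub>J ?m = 2 * (x * ?m)"
      by (simp add: jordan_prod_def peirce_rules)
    then have "2 * d (x * ?m) = (e \<circ>\<^sub>J d x) \<circ>\<^sub>J ?m + (e \<circ>\<^sub>J x) \<circ>\<^sub>J d ?m"
      using J [of "e \<circ>\<^sub>J x" ?m] double [of "x * ?m"] by (simp only: dE)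
    also have "\<dots> = 2 * (d x * ?m + x * d ?m)"
      unfolding dM by (simp add: jordan_prod_def peirce_rules algebra_simps)
    finally show ?thesis by (rule two_cancel)
  qed
  have right: "d ((e * y * f) * x) = d (e * y * f) * x + (e * y * f) * d x" for x y
  proof -
    let ?m = "e * y * f"
    have "?m \<circ>\<^sub>J (f \<circ>\<^sub>J x) = 2 * (?m * x)"
      by (simp add: jordan_prod_def peirce_rules)
    then have "2 * d (?m * x) = d ?m \<circ>\<^sub>J (f \<circ>\<^sub>J x) + ?m \<circ>\<^sub>J (f \<circ>\<^sub>J d x)"
      using J [of ?m "f \<circ>\<^sub>J x"] double [of "?m * x"] by (simp only: dF)
    also have "\<dots> = 2 * (d ?m * x + ?m * d x)"
      unfolding dM by (simp add: jordan_prod_def peirce_rules algebra_simps)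
    finally show ?thesis by (rule two_cancel)
  qed
  have dM_add: "d (e * x * f + e * y * f) = d (e * x * f) + d (e * y * f)" for x y
    using dM [of "x + y"] addM [of x y] dM [of x] dM [of y] by (simp add: distrib_left distrib_right)
  have "d (x + y) = d x + d y" for x y
  proof -
    have "d (x + y) - d x - d y = 0"
    proof (rule zeroI)
      fix z
      have "d (x * (e * z * f) + y * (e * z * f)) = d (x * (e * z * f)) + d (y * (e * z * f))"
        using dM_add [of "x * e * z" "y * e * z"] by (simp add: peirce_rules)
      then show "(d (x + y) - d x - d y) * (e * z * f) = 0"
        using left [of "x + y" z] left [of x z] left [of y z] by (simp add: algebra_simps)
      have "d ((e * z * f) * x + (e * z * f) * y) = d ((e * z * f) * x) + d ((e * z * f) * y)"
        using dM_add [of "z * f * x" "z * f * y"] by (simp add: peirce_rules)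
      then show "(e * z * f) * (d (x + y) - d x - d y) = 0"
        using right [of z "x + y"] right [of z x] right [of z y] by (simp add: algebra_simps)
    next
      show "e * (d (x + y) - d x - d y) * f = 0"
        using addM [of x y] by (simp add: algebra_simps)
    qed
    then show ?thesis by (simp add: algebra_simps)
  qed
  moreover have "d (x * y) = d x * y + x * d y" for x y
  proof -
    have "d (x * y) - d x * y - x * d y = 0"
    proof (rule zeroI)
      fix z
      have "y * (e * z * f) = e * (y * e * z) * f" "(e * z * f) * x = e * (z * f * x) * f"
        by (simp_all add: peirce_rules)
      then have "d (x * (y * (e * z * f))) = d x * (y * (e * z * f)) + x * d (y * (e * z * f))"
          "d (((e * z * f) * x) * y) = d ((e * z * f) * x) * y + ((e * z * f) * x) * d y"
        using left right by metis+
      then show "(d (x * y) - d x * y - x * d y) * (e * z * f) = 0"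
          "(e * z * f) * (d (x * y) - d x * y - x * d y) = 0"
        using left [of "x * y" z] left [of y z] right [of z "x * y"] right [of z x]
        by (simp_all add: algebra_simps)
    next
      have "e * (x * y) * f = e * (x * (e * y + f * y)) * f"
        by (simp flip: split_left)
      then have "d (e * (x * y) * f) = d (e * (x * e * y) * f + e * (x * f * y) * f)"
        by (simp add: peirce_rules)
      also have "\<dots> = d (x * (e * y * f)) + d ((e * x * f) * y)"
        unfolding dM_add by (simp add: peirce_rules)
      also have "\<dots> = d x * e * y * f + x * e * d y * f + e * d x * f * y + e * x * f * d y"
        unfolding left right dM by (simp add: mult.assoc)
      also have "\<dots> = e * (d x * (e * y + f * y)) * f + e * (x * (e * d y + f * d y)) * f"
        by (simp add: peirce_rules add_ac)
      finally show "e * (d (x * y) - d x * y - x * d y) * f = 0"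
        unfolding dM by (simp add: algebra_simps flip: split_left)
    qed
    then show ?thesis by (simp add: algebra_simps)
  qed
  ultimately show ?thesis by (simp add: ring_derivation_def)
qed

text \<open>On an idempotent \<open>g\<close> the hypotheses give \<open>d g = d g \<circ>\<^sub>J g\<close>. Together with
  \<open>d (e \<circ>\<^sub>J f) = 0\<close> it follows that \<open>q = d e\<close> lies in \<open>e A f\<close> and \<open>d f = - q\<close>, values which the inner derivation \<open>x q - q x\<close> takes as well.\<close>

lemma jordan_derivation_is_derivation:
  fixes d :: "'a \<Rightarrow> 'a"
  assumes J: "\<And>x y. d (x \<circ>\<^sub>J y) = d x \<circ>\<^sub>J y + x \<circ>\<^sub>J d y"
    and double: "\<And>x. d (2 * x) = 2 * d x"
  shows "ring_derivation d"
proof -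
  define q where "q = e * d e * f"
  define d' where "d' x = d x - (x * q - q * x)" for x
  have eq: "e * q = q" and qe: "q * e = 0" and qf: "q * f = q" and fq: "f * q = 0"
    by (simp_all add: q_def peirce_rules)
  have idem: "d x = d x \<circ>\<^sub>J x" if "x * x = x" for x
    using J [of x x] double [of x] that
    by - (rule two_cancel; simp add: jordan_prod_def mult_2 add_ac)
  have d0: "d 0 = 0" using double [of 0] by (simp add: mult_2)
  have de: "d e = q"
    using arg_cong [OF idem [OF e_idem], of "\<lambda>z. e * z * e"]
      arg_cong [OF idem [OF e_idem], of "\<lambda>z. f * z * f"]
    by - (rule peirce_eqI; simp add: q_def jordan_prod_def peirce_rules)
  have df: "d f = - q"
  proof -
    have "d e \<circ>\<^sub>J f + e \<circ>\<^sub>J d f = 0"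
      using J [of e f] d0 by (simp add: jordan_prod_def ef_zero fe_zero)
    from arg_cong [OF this, of "\<lambda>z. e * z * f"] have "q + e * d f * f = 0"
      by (simp add: de jordan_prod_def peirce_rules eq qe qf fq)
    then have "e * d f * f = - q" by (simp add: add_eq_0_iff)
    then show ?thesis
      using arg_cong [OF idem [OF f_idem], of "\<lambda>z. e * z * e"]
        arg_cong [OF idem [OF f_idem], of "\<lambda>z. f * z * f"]
      by - (rule peirce_eqI; simp add: jordan_prod_def peirce_rules eq qe qf fq)
  qed
  have "ring_derivation d'"
  proof (rule jordan_derivation_normalized)
    show "d' (x \<circ>\<^sub>J y) = d' x \<circ>\<^sub>J y + x \<circ>\<^sub>J d' y" for x y
      unfolding d'_def J by (simp add: jordan_prod_def algebra_simps)
    show "d' (2 * x) = 2 * d' x" for x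
      unfolding d'_def double by (simp add: mult_2 algebra_simps)
    show "d' e = 0" "d' f = 0"
      by (simp_all add: d'_def de df eq qe qf fq)
  qed
  moreover have "d x = d' x + (x * q - q * x)" for x by (simp add: d'_def)
  ultimately show ?thesis
    unfolding ring_derivation_def by (simp only:) (simp add: algebra_simps)
qed

section \<open>From n factors to two\<close>

lemma two_power_left_commute: "2 ^ k * (2 * x) = 2 * (2 ^ k * x)" for x :: 'a
  by (metis mult.assoc power_commutes)

lemma two_power_of_nat_commute: "2 ^ k * (of_nat j * x) = of_nat j * (2 ^ k * x)" for x :: 'a
  by (metis mult.assoc mult_of_nat_commute)

lemma two_of_nat_commute: "2 * (of_nat j * x) = of_nat j * (2 * x)" for x :: 'a
  by (metis mult.assoc mult_of_nat_commute)

lemmas scalar_rules = two_power_left_commute two_power_of_nat_commute two_of_nat_commute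
  jordan_prod_two_left jordan_prod_two_right
  jordan_prod_two_power_left jordan_prod_two_power_right
  distrib_left right_diff_distrib jordan_prod_add_left jordan_prod_diff_left

lemma jordan_centralizer_form:
  fixes G :: "'a \<Rightarrow> 'a"
  assumes G: "\<And>x y. G (2 ^ k * (x \<circ>\<^sub>J y)) = 2 ^ k * (G x \<circ>\<^sub>J y)"
  shows "G 1 \<in> ring_center" and "G x = G 1 * x"
proof -
  have half: "2 * G x = G 1 \<circ>\<^sub>J x" for x
  proof (rule two_power_cancel)
    show "2 ^ k * (2 * G x) = 2 ^ k * (G 1 \<circ>\<^sub>J x)"
      using G [of x 1] G [of 1 x] by (simp add: jordan_prod_one_left jordan_prod_one_right)
  qed
  have "G 1 \<circ>\<^sub>J (x \<circ>\<^sub>J y) = (G 1 \<circ>\<^sub>J x) \<circ>\<^sub>J y" for x y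
  proof (rule two_power_cancel)
    show "2 ^ k * (G 1 \<circ>\<^sub>J (x \<circ>\<^sub>J y)) = 2 ^ k * ((G 1 \<circ>\<^sub>J x) \<circ>\<^sub>J y)"
      using half [of "2 ^ k * (x \<circ>\<^sub>J y)"] unfolding G
      by (simp add: scalar_rules flip: half)
  qed
  then show central: "G 1 \<in> ring_center"
    by (rule central_if_jordan_centralizer)
  show "G x = G 1 * x"
  proof (rule two_cancel)
    show "2 * G x = 2 * (G 1 * x)"
      using half [of x] central by (simp add: ring_center_def jordan_prod_def mult_2)
  qed
qed

text \<open>
  The assumption is the two-variable form of the Jordan \<open>n\<close>-derivation identity. The map \<open>\<delta>\<close>
  is not known to be additive, so the factor \<open>2 ^ k\<close> inside \<open>\<delta>\<close> has to be removed by other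
  means: once by setting \<open>y = 1\<close>, which evaluates \<open>\<delta> (2 ^ k * (2 * x))\<close>, and once by iterating
  \<open>\<delta> (2 * x) = 2 * \<delta> x + D x\<close>. Comparing the two results shows that the defect \<open>D\<close> is
  multiplication by a central \<open>v\<close>.
\<close>

lemma jordan_n_derivation_form:
  fixes \<delta> :: "'a \<Rightarrow> 'a"
  defines "u \<equiv> \<delta> 1"
  assumes A: "\<And>x y. 2 * \<delta> (2 ^ k * (x \<circ>\<^sub>J y)) =
    2 * (2 ^ k * (\<delta> x \<circ>\<^sub>J y + x \<circ>\<^sub>J \<delta> y)) + of_nat k * (2 ^ k * ((x \<circ>\<^sub>J y) \<circ>\<^sub>J u))"
  shows "u \<in> ring_center" and "ring_derivation (\<lambda>x. \<delta> x - u * x)"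
proof -
  have B: "\<delta> (2 ^ k * (2 * x)) = 2 ^ k * (2 * \<delta> x + x \<circ>\<^sub>J u + of_nat k * (x \<circ>\<^sub>J u))" for x
    using A [of x 1] unfolding u_def [symmetric]
    by - (rule two_cancel; simp add: scalar_rules jordan_prod_one_right)
  have C: "2 * \<delta> (x \<circ>\<^sub>J y) + (x \<circ>\<^sub>J y) \<circ>\<^sub>J u = \<delta> (2 * x) \<circ>\<^sub>J y + 2 * (x \<circ>\<^sub>J \<delta> y)" for x y
  proof -
    have "2 * (2 ^ k * (2 * \<delta> (x \<circ>\<^sub>J y) + (x \<circ>\<^sub>J y) \<circ>\<^sub>J u))
        = 2 * (2 ^ k * (\<delta> (2 * x) \<circ>\<^sub>J y + 2 * (x \<circ>\<^sub>J \<delta> y)))"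
      using A [of "2 * x" y] unfolding jordan_prod_two_left B by (simp add: scalar_rules)
    from two_power_cancel [OF two_cancel [OF this]] show ?thesis .
  qed
  define D where "D x = \<delta> (2 * x) - 2 * \<delta> x" for x
  have D: "\<delta> (2 * x) = 2 * \<delta> x + D x" for x by (simp add: D_def)
  have C': "2 * \<delta> (x \<circ>\<^sub>J y) + (x \<circ>\<^sub>J y) \<circ>\<^sub>J u = 2 * (\<delta> x \<circ>\<^sub>J y + x \<circ>\<^sub>J \<delta> y) + D x \<circ>\<^sub>J y" for x y
    using C [of x y] by (simp add: D scalar_rules)
  have "D x \<circ>\<^sub>J y = D y \<circ>\<^sub>J x" for x y
    using C' [of x y] C' [of y x] by (simp add: jordan_prod_commute add.commute)
  from this [of _ 1] have half: "2 * D x = D 1 \<circ>\<^sub>J x" for x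
    by (simp add: jordan_prod_one_right)
  have D2: "D (2 * x) = 2 * D x" for x
    by (rule two_cancel) (simp add: half [of "2 * x"] jordan_prod_two_right flip: half)
  have pow: "2 * \<delta> (2 ^ j * x) = 2 * (2 ^ j * \<delta> x) + of_nat j * (2 ^ j * D x)" for j x
  proof (induction j arbitrary: x)
    case 0
    then show ?case by simp
  next
    case (Suc j)
    have "2 * \<delta> (2 ^ Suc j * x) = 2 * \<delta> (2 ^ j * (2 * x))"
      by (simp add: power_commutes mult.assoc scalar_rules)
    also have "\<dots> = 2 * (2 ^ Suc j * \<delta> x) + of_nat (Suc j) * (2 ^ Suc j * D x)"
      unfolding Suc D D2 by (simp add: scalar_rules mult.assoc distrib_right)
    finally show ?case .
  qed
  have E1: "2 * \<delta> (x \<circ>\<^sub>J y) + of_nat k * D (x \<circ>\<^sub>J y)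
      = 2 * (\<delta> x \<circ>\<^sub>J y + x \<circ>\<^sub>J \<delta> y) + of_nat k * ((x \<circ>\<^sub>J y) \<circ>\<^sub>J u)" for x y
    using A [of x y] unfolding pow by - (rule two_power_cancel; simp add: scalar_rules)
  have E2: "D x + of_nat k * D x = x \<circ>\<^sub>J u + of_nat k * (x \<circ>\<^sub>J u)" for x
  proof -
    have "2 * (2 ^ k * (D x + of_nat k * D x)) = 2 * (2 ^ k * (x \<circ>\<^sub>J u + of_nat k * (x \<circ>\<^sub>J u)))"
      using pow [of k "2 * x"] unfolding B D D2 by (simp add: scalar_rules)
    from two_power_cancel [OF two_cancel [OF this]] show ?thesis .
  qed
  \<comment> \<open>\<open>E1\<close> and \<open>C'\<close> both evaluate \<open>2 * \<delta> (x \<circ>\<^sub>J y)\<close>. In their difference \<open>u\<close> occurs with the factor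
    \<open>k + 1\<close>, which need not be cancellable but is the one that \<open>E2\<close> has.\<close>
  have DJ: "D (x \<circ>\<^sub>J y) = D x \<circ>\<^sub>J y" for x y
  proof -
    let ?z = "x \<circ>\<^sub>J y"
    have "D ?z = ?z \<circ>\<^sub>J u + (of_nat k * (?z \<circ>\<^sub>J u) - of_nat k * D ?z)"
      using E2 [of ?z] by (simp add: algebra_simps)
    also have "of_nat k * (?z \<circ>\<^sub>J u) - of_nat k * D ?z
        = 2 * \<delta> ?z - 2 * (\<delta> x \<circ>\<^sub>J y + x \<circ>\<^sub>J \<delta> y)"
      using E1 [of x y] by (simp add: algebra_simps)
    also have "?z \<circ>\<^sub>J u + \<dots> = D x \<circ>\<^sub>J y"
      using C' [of x y] by (simp add: algebra_simps)
    finally show ?thesis .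
  qed
  define v where "v = D 1"
  have v: "v \<in> ring_center"
  proof (rule central_if_jordan_centralizer)
    show "v \<circ>\<^sub>J (x \<circ>\<^sub>J y) = (v \<circ>\<^sub>J x) \<circ>\<^sub>J y" for x y
      unfolding v_def by (simp add: DJ jordan_prod_two_left flip: half)
  qed
  then have vc: "x * v = v * x" for x by (simp add: ring_center_def)
  have vc': "x * (v * y) = v * (x * y)" for x y by (metis vc mult.assoc)
  have Dv: "D x = v * x" for x
  proof (rule two_cancel)
    show "2 * D x = 2 * (v * x)"
      using half [of x] vc [of x] unfolding v_def [symmetric] by (simp add: jordan_prod_def mult_2)
  qed
  have idem: "2 * \<delta> g + g \<circ>\<^sub>J u = 2 * (\<delta> g \<circ>\<^sub>J g)" if g: "g * g = g" for g
  proof -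
    have gg: "g \<circ>\<^sub>J g = 2 * g" "(v * g) \<circ>\<^sub>J g = 2 * (v * g)"
      by (simp_all add: jordan_prod_def vc' mult_2 mult.assoc distrib_left g)
    have "2 * (2 * \<delta> g + g \<circ>\<^sub>J u) = 2 * (2 * (\<delta> g \<circ>\<^sub>J g))"
      using C' [of g g] unfolding gg D Dv by (simp add: scalar_rules jordan_prod_add_right jordan_prod_commute mult_2)
    then show ?thesis by (rule two_cancel)
  qed
  note ie = idem [OF e_idem] and if' = idem [OF f_idem]
  have eR: "\<delta> e * e = u * e"
    using arg_cong [OF ie, of "\<lambda>z. e * z * e"]
    by - (rule two_cancel; simp add: jordan_prod_def peirce_rules)
  have eS: "f * \<delta> e = 0"
    using arg_cong [OF ie, of "\<lambda>z. f * z * f"]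
    by - (rule double_zero; simp add: jordan_prod_def peirce_rules)
  have euf: "e * u * f = 0"
    using arg_cong [OF ie, of "\<lambda>z. e * z * f"] by (simp add: jordan_prod_def peirce_rules)
  have fS: "f * \<delta> f = f * u"
    using arg_cong [OF if', of "\<lambda>z. f * z * f"]
    by - (rule two_cancel; simp add: jordan_prod_def peirce_rules)
  have fR: "\<delta> f * e = 0"
    using arg_cong [OF if', of "\<lambda>z. e * z * e"]
    by - (rule double_zero; simp add: jordan_prod_def peirce_rules)
  have eR': "\<delta> e * (e * x) = u * (e * x)"
    and fS': "f * (\<delta> f * x) = f * (u * x)" and fR': "\<delta> f * (e * x) = 0" for x
    using eR fS fR by (simp_all flip: mult.assoc)
  \<comment> \<open>The identities of \<open>m = e x f\<close> with \<open>e\<close> and with \<open>f\<close> differ by the exchange of \<open>m u\<close> and \<open>u m\<close>;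
    their sum is \<open>2 * (v * m) = 0\<close>.\<close>
  have mE: "(e * x * f) * u = u * (e * x * f) + v * (e * x * f)"
    and mF: "u * (e * x * f) = (e * x * f) * u + v * (e * x * f)" for x
  proof -
    let ?m = "e * x * f"
    have me: "?m \<circ>\<^sub>J e = ?m" "?m \<circ>\<^sub>J f = ?m"
      by (simp_all add: jordan_prod_def peirce_rules)
    show "?m * u = u * ?m + v * ?m"
      using arg_cong [OF C' [of ?m e], of "\<lambda>z. e * z * f"] unfolding me Dv
      by (simp add: jordan_prod_def peirce_rules eS eR' vc vc')
    show "u * ?m = ?m * u + v * ?m"
      using arg_cong [OF C' [of ?m f], of "\<lambda>z. e * z * f"] unfolding me Dv
      by (simp add: jordan_prod_def peirce_rules fS fS' fR' vc vc')
  qed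
  have vm: "v * (e * x * f) = 0" for x
    using mE [of x] mF [of x] by - (rule double_zero; simp)
  show u: "u \<in> ring_center"
    using euf mE by (intro centralI) (simp_all add: vm)
  then have uc: "x * u = u * x" for x by (simp add: ring_center_def)
  have v0: "v = 0"
  proof (rule zeroI)
    show "v * (e * x * f) = 0" "(e * x * f) * v = 0" for x using vm [of x] vc by metis+
    show "e * v * f = 0" by (simp add: vc mult.assoc ef_zero)
  qed
  show "ring_derivation (\<lambda>x. \<delta> x - u * x)"
  proof (rule jordan_derivation_is_derivation)
    show "\<delta> (2 * x) - u * (2 * x) = 2 * (\<delta> x - u * x)" for x
      unfolding D Dv v0 by (simp add: mult_2 algebra_simps)
    have swap: "x * (u * y) = u * (x * y)" for x y
      using uc [of x] by (metis mult.assoc)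
    have "\<delta> (x \<circ>\<^sub>J y) + u * (x \<circ>\<^sub>J y) = \<delta> x \<circ>\<^sub>J y + x \<circ>\<^sub>J \<delta> y" for x y
      using C' [of x y]
      by - (rule two_cancel; simp add: Dv v0 jordan_prod_def [of _ u] jordan_prod_def [of 0] uc mult_2 distrib_left)
    then have "\<delta> (x \<circ>\<^sub>J y) = \<delta> x \<circ>\<^sub>J y + x \<circ>\<^sub>J \<delta> y - u * (x \<circ>\<^sub>J y)" for x y
      by (simp add: eq_diff_eq)
    then show "\<delta> (x \<circ>\<^sub>J y) - u * (x \<circ>\<^sub>J y)
        = (\<delta> x - u * x) \<circ>\<^sub>J y + x \<circ>\<^sub>J (\<delta> y - u * y)" for x y
      by (simp add: jordan_prod_def algebra_simps swap)
  qed
qed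

end

theorem corollary4p1:
  fixes n :: nat and e\<^sub>1 :: "'a::ring_1" and \<Delta> :: "'a \<Rightarrow> 'a"
  assumes "n \<ge> 2"
    and "triangular_ring e\<^sub>1"
    and "two_torsion_free TYPE('a)"
    and "mult_gen_jordan_derivation n \<Delta>"
  shows "\<exists>\<mu> \<delta>. \<mu> \<in> ring_center \<and> ring_derivation \<delta> \<and> (\<forall>t. \<Delta> t = \<mu> * t + \<delta> t)"
proof -
  interpret triangular_two_torsion_free e\<^sub>1 "1 - e\<^sub>1"
    using assms(2,3) by unfold_locales simp_all
  obtain k where n: "n = k + 2"
    using assms(1) by (metis add.commute le_Suc_ex)
  obtain \<delta> where \<delta>: "mult_jordan_derivation (k + 2) \<delta>"
    and \<Delta>: "\<And>t. \<Delta> (jordan_q (k + 2) t) = jordan_q (k + 2) (t(1 := \<Delta> (t 1)))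
          + (\<Sum>i=2..k+2. jordan_q (k + 2) (t(i := \<delta> (t i))))"
    using assms(4) unfolding n mult_gen_jordan_derivation_def by blast
  define G where "G x = \<Delta> x - \<delta> x" for x
  have "G (2 ^ k * (x \<circ>\<^sub>J y)) = 2 ^ k * (G x \<circ>\<^sub>J y)" for x y
    unfolding G_def by (rule gen_minus_derivation_two_args [OF \<delta> \<Delta>])
  note G = jordan_centralizer_form [of G, OF this]
  note d = jordan_n_derivation_form [of \<delta>, OF mult_jordan_derivation_two_args [OF \<delta>]]
  have "\<Delta> t = (G 1 + \<delta> 1) * t + (\<delta> t - \<delta> 1 * t)" for t
    using G(2) [of t] by (simp add: G_def [of t] algebra_simps)
  moreover have "G 1 + \<delta> 1 \<in> ring_center"
    using G(1) d(1) by (simp add: ring_center_def distrib_left distrib_right)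
  ultimately show ?thesis using d(2) by blast
qed

end
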